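(* Let $\mathcal{S}=(a_{n,m})_{n,m\geq 0}$ be an infinite matrix of complex numbers satisfying $a_{n+1,m}=a_{n,m+1}+m\,a_{n,m}$ for all $n,m\geq 0$, and let $b_n=a_{n,0}$. Then for every $n\geq 0$, $$\det\left(a_{i,j}\right)_{0\leq i,j\leq n}=\det\left(b_{i+j}\right)_{0\leq i,j\leq n}.$$ *)

theory Defs
  imports Complex_Main "Jordan_Normal_Form.Determinant"
begin

end

theory Submission
  imports Defs "HOL-Combinatorics.Stirling"
begin

text \<open>
  Iterating the recurrence expresses each antidiagonal entry \<open>b\<^bsub>i+j\<^esub>\<close> as
  \<open>\<Sum>\<^sub>k S(j,k) a\<^bsub>i,k\<^esub>\<close>, with \<open>S\<close> the Stirling numbers of the second kind. Hence
  the Hankel matrix of \<open>b\<close> is the matrix of \<open>a\<close> times a unitriangular matrix.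
\<close>

lemma first_column_eq_sum_Stirling:
  fixes a :: "nat \<Rightarrow> nat \<Rightarrow> 'a :: comm_semiring_1"
  assumes rec: "\<And>n m. a (Suc n) m = a n (Suc m) + of_nat m * a n m"
  shows "a (n + j) 0 = (\<Sum>k\<le>j. of_nat (Stirling j k) * a n k)"
proof (induction j arbitrary: n)
  case 0
  show ?case by simp
next
  case (Suc j)
  let ?S = "\<lambda>j k. of_nat (Stirling j k) :: 'a"
  \<comment> \<open>The index sum is regrouped as \<open>Suc n + j\<close>, so the induction
    hypothesis applies in row \<open>Suc n\<close>; \<open>rec\<close> then brings every entry back
    to row \<open>n\<close>.\<close>
  have "a (n + Suc j) 0 = (\<Sum>k\<le>j. ?S j k * a (Suc n) k)"
    using Suc.IH[of "Suc n"] by simp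
  also have "\<dots> = (\<Sum>k\<le>j. ?S j k * a n (Suc k)) + (\<Sum>k\<le>j. ?S j k * (of_nat k * a n k))"
    by (simp add: rec distrib_left sum.distrib)
  \<comment> \<open>The added term vanishes since \<open>Stirling j (Suc j) = 0\<close>. After the
    shift below, where the factor \<open>k\<close> kills the term at 0, both sums run over the same
    entries \<open>a n (Suc k)\<close>.\<close>
  also have "(\<Sum>k\<le>j. ?S j k * (of_nat k * a n k)) = (\<Sum>k\<le>Suc j. ?S j k * (of_nat k * a n k))"
    by simp
  also have "\<dots> = (\<Sum>k\<le>j. ?S j (Suc k) * (of_nat (Suc k) * a n (Suc k)))"
    by (subst sum.atMost_Suc_shift) (simp del: of_nat_Suc)
  \<comment> \<open>The coefficients merge by the Stirling recurrence S(j+1,k+1) = (k+1) S(j,k+1) +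
    S(j,k).\<close>
  also have "(\<Sum>k\<le>j. ?S j k * a n (Suc k)) + \<dots> = (\<Sum>k\<le>j. ?S (Suc j) (Suc k) * a n (Suc k))"
    by (simp add: sum.distrib [symmetric] algebra_simps)
  also have "\<dots> = (\<Sum>k\<le>Suc j. ?S (Suc j) k * a n k)"
    by (subst sum.atMost_Suc_shift) (simp del: Stirling.simps(4))
  finally show ?case .
qed

lemma det_eq_det_Hankel_first_column:
  fixes a :: "nat \<Rightarrow> nat \<Rightarrow> 'a :: idom"
  assumes rec: "\<And>n m. a (Suc n) m = a n (Suc m) + of_nat m * a n m"
  shows "det (mat N N (\<lambda>(i, j). a i j)) = det (mat N N (\<lambda>(i, j). a (i + j) 0))"
proof -
  define A where "A = mat N N (\<lambda>(i, j). a i j)"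
  \<comment> \<open>Row index \<open>k\<close> is the lower Stirling argument: column
    \<open>j\<close> of \<open>U\<close> lists the coefficients that combine the columns of
    \<open>A\<close> into column \<open>j\<close> of the Hankel matrix.\<close>
  define U where "U = mat N N (\<lambda>(k, j). of_nat (Stirling j k) :: 'a)"
  have A: "A \<in> carrier_mat N N" and U: "U \<in> carrier_mat N N"
    by (simp_all add: A_def U_def)
  have "mat N N (\<lambda>(i, j). a (i + j) 0) = A * U"
  proof (rule eq_matI)
    fix i j assume "i < dim_row (A * U)" "j < dim_col (A * U)"
    then have ij: "i < N" "j < N" by (simp_all add: A_def U_def)
    have "(A * U) $$ (i, j) = (\<Sum>k<N. of_nat (Stirling j k) * a i k)"
      using ij by (simp add: A_def U_def scalar_prod_def atLeast0LessThan mult.commute)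
    \<comment> \<open>The terms with \<open>k > j\<close> vanish, and \<open>j < N\<close> keeps all
      of \<open>{..j}\<close> inside the range.\<close>
    also have "\<dots> = (\<Sum>k\<le>j. of_nat (Stirling j k) * a i k)"
      using ij by (intro sum.mono_neutral_right) auto
    also have "\<dots> = a (i + j) 0"
      by (simp add: first_column_eq_sum_Stirling[of a, OF rec])
    finally show "mat N N (\<lambda>(i, j). a (i + j) 0) $$ (i, j) = (A * U) $$ (i, j)"
      using ij by simp
  qed (simp_all add: A_def U_def)
  moreover have "det U = 1"
  proof -
    have "upper_triangular U"
      by (auto simp: U_def)
    then have "det U = prod_list (diag_mat U)"
      using U by (rule det_upper_triangular)
    also have "\<dots> = 1"
      by (simp add: prod_list_diag_prod U_def)
    finally show ?thesis .
  qed
  ultimately show ?thesis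
    using det_mult[OF A U] by (simp add: A_def)
qed

theorem theorem5:
  fixes a :: "nat \<Rightarrow> nat \<Rightarrow> complex" and b :: "nat \<Rightarrow> complex"
  assumes rec: "\<And>n m. a (n + 1) m = a n (m + 1) + of_nat m * a n m"
    and b: "\<And>n. b n = a n 0"
  shows "\<forall>n. det (mat (n + 1) (n + 1) (\<lambda>(i, j). a i j))
           = det (mat (n + 1) (n + 1) (\<lambda>(i, j). b (i + j)))"
  using rec unfolding b by (intro allI det_eq_det_Hankel_first_column) simp

end
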